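(* Let $N\ge 1$ and $m>0$ be integers and let $Q=[0,1]^N\subset\mathbf{R}^N$. Then the set $\mathcal{P}$ of all real polynomials in $N$ variables (restricted to $Q$) is dense in $C^m(\bar Q)$ with respect to the $W^{m,\infty}$-norm. That is, for every $u\in C^m(\bar Q)$ and every $\varepsilon>0$ there is a polynomial $P\in\mathcal{P}$ such that $$\|u-P\|_{W^{m,\infty}(Q)}=\sum_{|\alpha|\le m}\|D^{\alpha}(u-P)\|_{L^{\infty}(Q)}<\varepsilon .$$
   Context: $\mathcal{P}$ denotes the set of all real polynomials on $\mathbf{R}^N$. For a multi-index $\alpha=(\alpha_1,\dots,\alpha_N)$ of non-negative integers, $|\alpha|=\alpha_1+\dots+\alpha_N$ and $D^{\alpha}$ is the corresponding partial derivative. $C^m(\bar Q)$ denotes the real-valued functions that are $m$ times continuously differentiable on the closed cube, i.e. functions $u$ that are $m$ times continuously differentiable in the interior $(0,1)^N$ and all of whose partial derivatives $D^{\alpha}u$, $|\alpha|\le m$, extend continuously to the closed cube $\bar Q=[0,1]^N$. The Sobolev norm is $\|u\|_{W^{m,\infty}(Q)}=\sum_{|\alpha|\le m}\|D^{\alpha}u\|_{L^{\infty}(Q)}$. *)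

theory Defs
  imports "HOL-Analysis.Analysis" "HOL-Probability.Essential_Supremum"
begin

definition unit_cube :: "(real ^ 'n) set" where
  "unit_cube = cbox 0 1"

definition partial_differentiable_at :: "'n \<Rightarrow> (real ^ 'n \<Rightarrow> real) \<Rightarrow> real ^ 'n \<Rightarrow> bool" where
  "partial_differentiable_at i f x \<longleftrightarrow> (\<lambda>t. f (x + t *\<^sub>R axis i 1)) field_differentiable (at 0)"

definition partial_deriv :: "'n \<Rightarrow> (real ^ 'n \<Rightarrow> real) \<Rightarrow> real ^ 'n \<Rightarrow> real" where
  "partial_deriv i f x = deriv (\<lambda>t. f (x + t *\<^sub>R axis i 1)) 0"

text \<open>Meant for open \<open>U\<close>: all iterated partial derivatives of order at most \<open>k\<close>, taken in any
  order of differentiation, exist and are continuous on \<open>U\<close>.\<close>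

fun times_cont_diff_on :: "nat \<Rightarrow> (real ^ 'n) set \<Rightarrow> (real ^ 'n \<Rightarrow> real) \<Rightarrow> bool" where
  "times_cont_diff_on 0 U f \<longleftrightarrow> continuous_on U f"
| "times_cont_diff_on (Suc k) U f \<longleftrightarrow> continuous_on U f \<and>
     (\<forall>i. (\<forall>x\<in>U. partial_differentiable_at i f x) \<and> times_cont_diff_on k U (partial_deriv i f))"

text \<open>A multi-index is a function on the index type.  The linear order of the index type plays the
  role of the numbering of the coordinates: for \<open>i\<^sub>1 < \<dots> < i\<^sub>N\<close> the operator below is
  \<open>\<partial>\<^bsub>i\<^sub>1\<^esub>\<^bsup>\<alpha> i\<^sub>1\<^esup> \<dots> \<partial>\<^bsub>i\<^sub>N\<^esub>\<^bsup>\<alpha> i\<^sub>N\<^esup>\<close>.\<close>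

definition multi_deriv ::
    "('n::{finite,linorder} \<Rightarrow> nat) \<Rightarrow> (real ^ 'n::{finite,linorder} \<Rightarrow> real)
      \<Rightarrow> real ^ 'n::{finite,linorder} \<Rightarrow> real" where
  "multi_deriv \<alpha> = foldr (\<lambda>i. partial_deriv i ^^ \<alpha> i) (sorted_list_of_set UNIV)"

definition multi_indices :: "nat \<Rightarrow> ('n::finite \<Rightarrow> nat) set" where
  "multi_indices m = {\<alpha>. (\<Sum>i\<in>UNIV. \<alpha> i) \<le> m}"

lemma finite_multi_indices: "finite (multi_indices m :: ('n::finite \<Rightarrow> nat) set)"
proof (rule finite_subset)
  show "(multi_indices m :: ('n \<Rightarrow> nat) set) \<subseteq> PiE UNIV (\<lambda>_. {..m})"
    using member_le_sum[of _ UNIV "_ :: 'n \<Rightarrow> nat"]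
    by (fastforce simp: multi_indices_def PiE_def intro: order_trans)
  show "finite (PiE (UNIV :: 'n set) (\<lambda>_. {..m}))"
    by (rule finite_PiE) auto
qed

definition C_closed_cube :: "nat \<Rightarrow> (real ^ 'n::{finite,linorder} \<Rightarrow> real) set" where
  "C_closed_cube m = {u. continuous_on unit_cube u \<and>
     times_cont_diff_on m (interior unit_cube) u \<and>
     (\<forall>\<alpha>\<in>multi_indices m. \<exists>g. continuous_on unit_cube g \<and>
        (\<forall>x\<in>interior unit_cube. g x = multi_deriv \<alpha> u x))}"

text \<open>The boundary of the cube is a null set, so the (arbitrary) values of the derivatives there
  do not affect the essential supremum.  Values are extended reals; \<open>esssup\<close> is \<open>\<infinity>\<close> for functions
  that are not measurable.\<close>

definition Linfty_norm :: "(real ^ 'n::finite) set \<Rightarrow> (real ^ 'n \<Rightarrow> real) \<Rightarrow> ereal" where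
  "Linfty_norm A f = esssup (lebesgue_on A) (\<lambda>x. ereal \<bar>f x\<bar>)"

definition sobolev_infty_norm :: "nat \<Rightarrow> (real ^ 'n::{finite,linorder} \<Rightarrow> real) \<Rightarrow> ereal" where
  "sobolev_infty_norm m u = (\<Sum>\<alpha>\<in>multi_indices m. Linfty_norm unit_cube (multi_deriv \<alpha> u))"

end

(* Shrinking u slightly towards the centre of the cube changes its derivatives of order at most m
   little in the sup norm (they extend continuously to the closed cube) and makes u of class C^m on an
   open neighbourhood of the closed cube.  There one applies Bernstein operators, one coordinate at a
   time.  The operator in direction i commutes with the derivatives in the other directions, and its
   a-th derivative in direction i is a Bernstein operator applied to a-th difference quotients, which
   converge to the a-th derivative.  Hence, once the mixed derivatives are reordered, all derivatives
   of order at most m converge uniformly on the cube, and the result is polynomial in coordinate i. *)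
theory Submission imports Defs "HOL-Real_Asymp.Real_Asymp" begin

subsection \<open>Iterated partial derivatives\<close>

text \<open>The obstacle is the boundary: derivatives of \<open>u\<close> are given only in the open
  cube, while the nodes \<open>k / n\<close> include 0 and 1 and the mean value theorem is used with
  two-sided derivatives on all of \<open>{0..1}\<close>. Working in one coordinate leaves a
  one-dimensional estimate whose threshold depends on the function only through a bound and a
  modulus of continuity of its derivative of order \<open>a\<close>. On all lines parallel to an
  axis, both come from one function that is uniformly continuous on the cube; this gives uniformity
  in the remaining coordinates. The output of one operator is the input of the next, so it has to be
  of class C^m on the same open set. That set must therefore contain, with each point, all points
  obtained by replacing a coordinate by a number in \<open>{0..1}\<close>.\<close>

lemma has_partial_deriv:
  "partial_differentiable_at i f x \<Longrightarrow>
    ((\<lambda>t. f (x + t *\<^sub>R axis i 1)) has_real_derivative partial_deriv i f x) (at 0)"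
  by (simp add: partial_deriv_def partial_differentiable_at_def DERIV_deriv_iff_field_differentiable)

lemma partial_derivI:
  assumes "((\<lambda>t. f (x + t *\<^sub>R axis i 1)) has_real_derivative d) (at 0)"
  shows "partial_differentiable_at i f x" and "partial_deriv i f x = d"
  unfolding partial_deriv_def partial_differentiable_at_def field_differentiable_def
  using assms by (blast, rule DERIV_imp_deriv)

lemma partial_deriv_line:
  assumes "partial_differentiable_at i f (y + r *\<^sub>R axis i 1)"
  shows "((\<lambda>t. f (y + t *\<^sub>R axis i 1)) has_real_derivative partial_deriv i f (y + r *\<^sub>R axis i 1)) (at r)"
  using has_partial_deriv[OF assms] DERIV_shift[of "\<lambda>t. f (y + t *\<^sub>R axis i 1)" _ 0 r]
  by (simp add: algebra_simps)

lemma eventually_line_in_open: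
  fixes x :: "real ^ 'n"
  assumes "open U" "x \<in> U"
  shows "\<forall>\<^sub>F t in nhds 0. x + t *\<^sub>R axis i 1 \<in> U"
proof -
  have "((\<lambda>t. x + t *\<^sub>R axis i (1::real)) \<longlongrightarrow> x + 0 *\<^sub>R axis i 1) (nhds 0)"
    by (intro tendsto_intros) (simp add: filterlim_ident)
  from topological_tendstoD[OF this assms(1)] show ?thesis
    using assms(2) by simp
qed

text \<open>A partial derivative at \<open>x\<close> sees only values on a short segment around
  \<open>x\<close>, which stays in the open set \<open>U\<close>. Identities valid merely on
  \<open>U\<close> may thus be differentiated, as the inductions on words below require.\<close>

lemma partial_cong:
  fixes f g :: "real ^ 'n \<Rightarrow> real"
  assumes "open U" "x \<in> U" "\<And>y. y \<in> U \<Longrightarrow> f y = g y"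
  shows "partial_deriv i f x = partial_deriv i g x"
    and "partial_differentiable_at i f x \<longleftrightarrow> partial_differentiable_at i g x"
proof -
  have ev: "\<forall>\<^sub>F t in nhds 0. f (x + t *\<^sub>R axis i 1) = g (x + t *\<^sub>R axis i 1)"
    using eventually_line_in_open[OF assms(1,2), of i] by eventually_elim (simp add: assms(3))
  then show "partial_deriv i f x = partial_deriv i g x"
    unfolding partial_deriv_def by (rule deriv_cong_ev) simp
  show "partial_differentiable_at i f x \<longleftrightarrow> partial_differentiable_at i g x"
    unfolding partial_differentiable_at_def field_differentiable_def
    using DERIV_cong_ev[OF refl ev refl] by simp
qed

lemma times_cont_diff_on_cong:
  assumes "open U" "\<And>y. y \<in> U \<Longrightarrow> f y = g y" "times_cont_diff_on k U f"
  shows "times_cont_diff_on k U g"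
  using assms(2,3)
proof (induction k arbitrary: f g)
  case 0
  then have "continuous_on U f" by simp
  then have "continuous_on U g" by (rule continuous_on_eq) (rule 0)
  then show ?case by simp
next
  case (Suc k)
  have cont: "continuous_on U f" and diff: "\<And>i x. x \<in> U \<Longrightarrow> partial_differentiable_at i f x"
    and smooth: "\<And>i. times_cont_diff_on k U (partial_deriv i f)"
    using Suc.prems(2) by simp_all
  have "times_cont_diff_on k U (partial_deriv i g)" for i
  proof (rule Suc.IH[OF _ smooth])
    show "partial_deriv i f y = partial_deriv i g y" if "y \<in> U" for y
      by (rule partial_cong(1)[OF assms(1) that Suc.prems(1)])
  qed
  moreover have "partial_differentiable_at i g x" if "x \<in> U" for i x
    by (rule iffD1[OF partial_cong(2)[OF assms(1) that Suc.prems(1)] diff[OF that]])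
  moreover have "continuous_on U g"
    using cont by (rule continuous_on_eq) (rule Suc.prems(1))
  ultimately show ?case by simp
qed

lemma times_cont_diff_on_imp_continuous: "times_cont_diff_on k U f \<Longrightarrow> continuous_on U f"
  by (cases k) auto

lemma times_cont_diff_on_mono:
  "times_cont_diff_on k U f \<Longrightarrow> l \<le> k \<Longrightarrow> times_cont_diff_on l U f"
proof (induction k arbitrary: f l)
  case (Suc k)
  note IH = Suc.IH and prems = Suc.prems
  show ?case
  proof (cases l)
    case (Suc l')
    have "times_cont_diff_on l' U (partial_deriv i f)" for i
      by (rule IH) (use prems \<open>l = Suc l'\<close> in simp_all)
    with prems(1) show ?thesis by (simp add: \<open>l = Suc l'\<close>)
  qed (use prems in simp)
qed simp

text \<open>Derivatives are indexed by words of directions, so that inductions add one letter at a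
  time in any order. The head of the list is the derivative taken last.\<close>

abbreviation iter_deriv :: "'n list \<Rightarrow> (real ^ 'n \<Rightarrow> real) \<Rightarrow> real ^ 'n \<Rightarrow> real" where
  "iter_deriv \<equiv> foldr partial_deriv"

lemma times_cont_diff_on_iter_deriv:
  "times_cont_diff_on (length w + k) U f \<Longrightarrow> times_cont_diff_on k U (iter_deriv w f)"
proof (induction w arbitrary: k)
  case (Cons i w)
  then show ?case using Cons.IH[of "Suc k"] by simp
qed simp

lemma iter_deriv_continuous:
  assumes "times_cont_diff_on m U f" "length w \<le> m"
  shows "continuous_on U (iter_deriv w f)"
  using times_cont_diff_on_iter_deriv[of w "m - length w" U f] assms
    times_cont_diff_on_imp_continuous[of "m - length w" U "iter_deriv w f"] by simp

lemma iter_deriv_differentiable: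
  assumes "times_cont_diff_on m U f" "length w < m" "x \<in> U"
  shows "partial_differentiable_at i (iter_deriv w f) x"
proof -
  have "times_cont_diff_on (Suc (m - length w - 1)) U (iter_deriv w f)"
    using assms by (intro times_cont_diff_on_iter_deriv) simp
  then show ?thesis using assms(3) by simp
qed

lemma iter_deriv_diff:
  assumes "open U" "times_cont_diff_on m U f" "times_cont_diff_on m U g" "length w \<le> m" "x \<in> U"
  shows "iter_deriv w (\<lambda>x. f x - g x) x = iter_deriv w f x - iter_deriv w g x"
  using assms(4,5)
proof (induction w arbitrary: x)
  case (Cons i w)
  have "partial_deriv i (iter_deriv w (\<lambda>x. f x - g x)) x
      = partial_deriv i (\<lambda>x. iter_deriv w f x - iter_deriv w g x) x"
    using Cons by (intro partial_cong(1)[OF assms(1)]) auto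
  also have "\<dots> = partial_deriv i (iter_deriv w f) x - partial_deriv i (iter_deriv w g) x"
    using Cons.prems iter_deriv_differentiable[OF assms(2)] iter_deriv_differentiable[OF assms(3)]
    by (intro partial_derivI(2) DERIV_diff has_partial_deriv) auto
  finally show ?case by simp
qed simp

subsection \<open>Symmetry of mixed partial derivatives\<close>

text \<open>Two mean value steps, along axis \<open>i\<close> and then along axis \<open>j\<close>.
  The double difference is symmetric in \<open>i\<close> and \<open>j\<close>, the right-hand side
  is not; this is the source of the symmetry of mixed derivatives. All points used are within
  \<open>2 * h\<close> of \<open>x\<close>, hence inside the ball.\<close>

lemma double_difference_mvt:
  fixes f :: "real ^ 'n \<Rightarrow> real"
  assumes f: "times_cont_diff_on (Suc (Suc 0)) U f" and h: "h > 0" and U: "ball x (3 * h) \<subseteq> U"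
  shows "\<exists>p\<in>ball x (3 * h).
    f (x + h *\<^sub>R axis i 1 + h *\<^sub>R axis j 1) - f (x + h *\<^sub>R axis i 1) - f (x + h *\<^sub>R axis j 1) + f x
      = h * h * partial_deriv j (partial_deriv i f) p"
proof -
  have inU: "x + s *\<^sub>R axis i 1 + t *\<^sub>R axis j 1 \<in> ball x (3 * h)"
    if "0 \<le> s" "s \<le> h" "0 \<le> t" "t \<le> h" for s t
  proof -
    have "norm (s *\<^sub>R axis i (1::real) + t *\<^sub>R axis j (1::real)) \<le> s + t"
      using norm_triangle_ineq[of "s *\<^sub>R axis i (1::real)" "t *\<^sub>R axis j (1::real)"] that by simp
    moreover have "dist x (x + s *\<^sub>R axis i 1 + t *\<^sub>R axis j 1)
        = norm (s *\<^sub>R axis i (1::real) + t *\<^sub>R axis j (1::real))"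
      by (metis add.assoc add_diff_cancel_left' dist_commute dist_norm)
    ultimately show ?thesis using that h by simp
  qed
  \<comment> \<open>The difference across a step \<open>h\<close> along axis \<open>j\<close>, as a
    function of the position along axis \<open>i\<close>; \<open>g h - g 0\<close> is the double
    difference.\<close>
  define g where "g s = f (x + s *\<^sub>R axis i 1 + h *\<^sub>R axis j 1) - f (x + s *\<^sub>R axis i 1)" for s
  define g' where "g' s = partial_deriv i f (x + s *\<^sub>R axis i 1 + h *\<^sub>R axis j 1)
      - partial_deriv i f (x + s *\<^sub>R axis i 1)" for s
  have "(g has_real_derivative g' s) (at s)" if "0 \<le> s" "s \<le> h" for s
  proof -
    have "x + s *\<^sub>R axis i 1 + h *\<^sub>R axis j 1 \<in> U" "x + s *\<^sub>R axis i 1 \<in> U"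
      using inU[of s h] inU[of s 0] that h U by auto
    then have "partial_differentiable_at i f (x + h *\<^sub>R axis j 1 + s *\<^sub>R axis i 1)"
      "partial_differentiable_at i f (x + s *\<^sub>R axis i 1)"
      using f by (auto simp: add_ac)
    from this[THEN partial_deriv_line] show ?thesis
      unfolding g_def g'_def by (intro DERIV_diff) (simp_all add: add_ac)
  qed
  from MVT2[OF h this] obtain s where s: "0 < s" "s < h" "g h - g 0 = h * g' s"
    by auto
  have "((\<lambda>t. partial_deriv i f (x + s *\<^sub>R axis i 1 + t *\<^sub>R axis j 1)) has_real_derivative
      partial_deriv j (partial_deriv i f) (x + s *\<^sub>R axis i 1 + t *\<^sub>R axis j 1)) (at t)"
    if "0 \<le> t" "t \<le> h" for t
    using inU[of s t] that s U f by (intro partial_deriv_line) auto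
  from MVT2[OF h this] obtain t where t: "0 < t" "t < h"
    "g' s = h * partial_deriv j (partial_deriv i f) (x + s *\<^sub>R axis i 1 + t *\<^sub>R axis j 1)"
    unfolding g'_def by auto
  show ?thesis
    using inU[of s t] s t
    by (intro bexI[of _ "x + s *\<^sub>R axis i 1 + t *\<^sub>R axis j 1"]) (auto simp: g_def)
qed

lemma partial_deriv_commute:
  fixes f :: "real ^ 'n \<Rightarrow> real"
  assumes U: "open U" and x: "x \<in> U" and f: "times_cont_diff_on (Suc (Suc 0)) U f"
  shows "partial_deriv i (partial_deriv j f) x = partial_deriv j (partial_deriv i f) x"
proof (rule ccontr)
  let ?A = "partial_deriv i (partial_deriv j f)" and ?B = "partial_deriv j (partial_deriv i f)"
  assume neq: "?A x \<noteq> ?B x"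
  \<comment> \<open>With half the gap as tolerance, the \<open>e\<close>-neighbourhoods of
    \<open>?A x\<close> and \<open>?B x\<close> are disjoint, yet the common value
    \<open>?B p = ?A q\<close> would lie in both.\<close>
  define e where "e = \<bar>?A x - ?B x\<bar> / 2"
  have e: "e > 0" using neq by (simp add: e_def)
  have "isCont ?A x" "isCont ?B x"
    using f U x by (auto simp: continuous_on_eq_continuous_at)
  then obtain d1 d2 where d: "d1 > 0" "\<And>y. dist y x < d1 \<Longrightarrow> dist (?A y) (?A x) < e"
      "d2 > 0" "\<And>y. dist y x < d2 \<Longrightarrow> dist (?B y) (?B x) < e"
    using e unfolding continuous_at_eps_delta by metis
  obtain d3 where d3: "d3 > 0" "ball x d3 \<subseteq> U"
    using U x openE by blast
  define h where "h = min d1 (min d2 d3) / 3"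
  have h: "h > 0" "3 * h \<le> d1" "3 * h \<le> d2" "3 * h \<le> d3"
    using d d3 by (auto simp: h_def)
  have bU: "ball x (3 * h) \<subseteq> U"
    using d3(2) h(4) by fastforce
  obtain p where p: "p \<in> ball x (3 * h)" "f (x + h *\<^sub>R axis i 1 + h *\<^sub>R axis j 1)
      - f (x + h *\<^sub>R axis i 1) - f (x + h *\<^sub>R axis j 1) + f x = h * h * ?B p"
    using double_difference_mvt[OF f h(1) bU, of i j] by blast
  obtain q where q: "q \<in> ball x (3 * h)" "f (x + h *\<^sub>R axis j 1 + h *\<^sub>R axis i 1)
      - f (x + h *\<^sub>R axis j 1) - f (x + h *\<^sub>R axis i 1) + f x = h * h * ?A q"
    using double_difference_mvt[OF f h(1) bU, of j i] by blast
  have pq: "h * h * ?B p = h * h * ?A q"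
  proof -
    have "x + h *\<^sub>R axis i 1 + h *\<^sub>R axis j 1 = x + h *\<^sub>R axis j 1 + h *\<^sub>R axis i 1"
      by (simp add: add_ac)
    with p(2) q(2) show ?thesis by (simp only: diff_diff_eq add.commute)
  qed
  have "?B p = ?A q" using pq h(1) by simp
  moreover have "dist (?B p) (?B x) < e" "dist (?A q) (?A x) < e"
    using p(1) q(1) h d by (auto simp: dist_commute)
  ultimately show False
    unfolding e_def dist_real_def by (simp add: abs_if split: if_splits)
qed

lemma partial_deriv_funpow_commute:
  fixes f :: "real ^ 'n \<Rightarrow> real"
  assumes U: "open U" and f: "times_cont_diff_on m U f" and a: "Suc a \<le> m" and x: "x \<in> U"
  shows "partial_deriv j ((partial_deriv i ^^ a) f) x = (partial_deriv i ^^ a) (partial_deriv j f) x"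
  using a x
proof (induction a arbitrary: x)
  case (Suc a)
  have pow: "(partial_deriv i ^^ a) f = iter_deriv (replicate a i) f"
    by (induction a) auto
  have "times_cont_diff_on (Suc (Suc 0)) U ((partial_deriv i ^^ a) f)"
    unfolding pow
    by (intro times_cont_diff_on_iter_deriv times_cont_diff_on_mono[OF f]) (use Suc.prems in simp)
  then have "partial_deriv j ((partial_deriv i ^^ Suc a) f) x
      = partial_deriv i (partial_deriv j ((partial_deriv i ^^ a) f)) x"
    using partial_deriv_commute[OF U Suc.prems(2)] by simp
  also have "\<dots> = partial_deriv i ((partial_deriv i ^^ a) (partial_deriv j f)) x"
    using Suc by (intro partial_cong(1)[OF U]) auto
  finally show ?case by simp
qed simp

text \<open>With the letters \<open>i\<close> applied last, the derivative can be read as a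
  one-variable derivative of order \<open>count_list w i\<close> along lines parallel to axis
  \<open>i\<close>, which is what the one-dimensional estimate controls.\<close>

lemma iter_deriv_collect:
  fixes f :: "real ^ 'n \<Rightarrow> real"
  assumes U: "open U" and f: "times_cont_diff_on m U f" and w: "length w \<le> m" and x: "x \<in> U"
  shows "iter_deriv w f x
    = (partial_deriv i ^^ count_list w i) (iter_deriv (filter (\<lambda>j. j \<noteq> i) w) f) x"
  using w x
proof (induction w arbitrary: x)
  case (Cons j w)
  let ?v = "filter (\<lambda>j. j \<noteq> i) w"
  have eq: "partial_deriv j (iter_deriv w f) x
      = partial_deriv j ((partial_deriv i ^^ count_list w i) (iter_deriv ?v f)) x"
    using Cons by (intro partial_cong(1)[OF U]) auto
  have len: "length ?v + count_list w i = length w"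
    by (induction w) auto
  have "times_cont_diff_on (Suc (count_list w i)) U (iter_deriv ?v f)"
    by (intro times_cont_diff_on_iter_deriv times_cont_diff_on_mono[OF f]) (use Cons.prems len in simp)
  with eq show ?case
    using partial_deriv_funpow_commute[OF U _ le_refl Cons.prems(2)] by (auto simp: funpow_swap1)
qed simp

subsection \<open>Derivatives of Bernstein polynomials in one variable\<close>

text \<open>A formal polynomial in place of the function \<open>Bernstein\<close>, so that higher
  derivatives are iterates of \<open>pderiv\<close> and can be computed algebraically.\<close>

definition bernstein_poly :: "nat \<Rightarrow> nat \<Rightarrow> real poly" where
  "bernstein_poly n k = smult (of_nat (n choose k)) ([:0, 1:] ^ k * [:1, -1:] ^ (n - k))"

lemma poly_bernstein_poly: "poly (bernstein_poly n k) x = Bernstein n k x"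
  by (simp add: bernstein_poly_def Bernstein_def poly_power)

lemma bernstein_poly_eq_0: "n < k \<Longrightarrow> bernstein_poly n k = 0"
  by (simp add: bernstein_poly_def)

lemma pderiv_bernstein_poly_0:
  "pderiv (bernstein_poly (Suc n) 0) = smult (real (Suc n)) (- bernstein_poly n 0)"
  by (simp add: bernstein_poly_def pderiv_smult pderiv_power_Suc pderiv_pCons del: power_Suc of_nat_Suc One_nat_def)

lemma pderiv_bernstein_poly_Suc:
  "pderiv (bernstein_poly (Suc n) (Suc k))
    = smult (real (Suc n)) (bernstein_poly n k - bernstein_poly n (Suc k))"
proof -
  let ?X = "[:0, 1:] :: real poly" and ?Y = "[:1, -1:] :: real poly"
  have X: "pderiv (?X ^ Suc k) = smult (real (Suc k)) (?X ^ k)"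
    by (simp add: pderiv_power_Suc pderiv_pCons del: power_Suc)
  \<comment> \<open>Truncated subtraction is harmless: for \<open>n \<le> k\<close> the power on the
    left is constant and the coefficient \<open>real (n - k)\<close> on the right is 0.\<close>
  have Y: "pderiv (?Y ^ (n - k)) = smult (- real (n - k)) (?Y ^ (n - Suc k))"
  proof (cases "n - k")
    case (Suc l)
    then have "n - Suc k = l" by simp
    with Suc show ?thesis
      by (simp add: pderiv_power_Suc pderiv_pCons del: power_Suc of_nat_Suc)
  qed simp
  \<comment> \<open>The absorption identities \<open>c1\<close> and \<open>c2\<close> turn the two
    coefficients of the product rule into \<open>Suc n\<close> times binomial coefficients of degree
    \<open>n\<close>.\<close>
  have c1: "real (Suc n choose Suc k) * real (Suc k) = real (Suc n) * real (n choose k)"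
    using Suc_times_binomial_eq[of n k] by (metis mult.commute of_nat_mult)
  have c2: "real (Suc n choose Suc k) * real (n - k) = real (Suc n) * real (n choose Suc k)"
    using binomial_absorb_comp[of "Suc n" "Suc k"] by (metis diff_Suc_1 diff_Suc_Suc mult.commute of_nat_mult)
  have "pderiv (bernstein_poly (Suc n) (Suc k))
      = smult (real (Suc n choose Suc k)) (?X ^ Suc k * smult (- real (n - k)) (?Y ^ (n - Suc k))
        + ?Y ^ (n - k) * smult (real (Suc k)) (?X ^ k))"
    unfolding bernstein_poly_def diff_Suc_Suc pderiv_smult pderiv_mult X Y ..
  also have "\<dots> = smult (real (Suc n choose Suc k) * real (Suc k)) (?X ^ k * ?Y ^ (n - k))
      - smult (real (Suc n choose Suc k) * real (n - k)) (?X ^ Suc k * ?Y ^ (n - Suc k))"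
    by (simp only: smult_add_right mult_smult_right smult_smult mult_minus_right smult_minus_left smult_minus_right
        mult.commute[of "?Y ^ (n - k)"] diff_conv_add_uminus add.commute)
  also have "\<dots> = smult (real (Suc n)) (bernstein_poly n k - bernstein_poly n (Suc k))"
    unfolding c1 c2 bernstein_poly_def by (simp only: smult_diff_right smult_smult)
  finally show ?thesis .
qed

abbreviation forward_diff :: "(nat \<Rightarrow> real) \<Rightarrow> nat \<Rightarrow> real" where
  "forward_diff c k \<equiv> c (Suc k) - c k"

lemma smult_sum_right: "smult c (\<Sum>x\<in>A. f x) = (\<Sum>x\<in>A. smult c (f x))"
  by (induction A rule: infinite_finite_induct) (auto simp: smult_add_right)

text \<open>Summation by parts: the derivative of a basis polynomial is a difference of neighbours,
  and the difference is moved onto the coefficients. No boundary term remains, since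
  \<open>bernstein_poly n (Suc n)\<close> is 0.\<close>

lemma pderiv_bernstein_sum:
  "pderiv (\<Sum>k\<le>Suc n. smult (c k) (bernstein_poly (Suc n) k))
    = smult (real (Suc n)) (\<Sum>k\<le>n. smult (forward_diff c k) (bernstein_poly n k))"
proof -
  have "pderiv (\<Sum>k\<le>Suc n. smult (c k) (bernstein_poly (Suc n) k))
     = smult (real (Suc n)) (smult (c 0) (- bernstein_poly n 0)
        + (\<Sum>k\<le>n. smult (c (Suc k)) (bernstein_poly n k - bernstein_poly n (Suc k))))"
    unfolding sum.atMost_Suc_shift pderiv_add higher_pderiv_sum[of 1, simplified] pderiv_smult
      pderiv_bernstein_poly_0 pderiv_bernstein_poly_Suc smult_add_right
    by (simp add: smult_smult mult.commute[of _ "real (Suc n)"] smult_sum_right del: of_nat_Suc)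
  also have "smult (c 0) (- bernstein_poly n 0)
        + (\<Sum>k\<le>n. smult (c (Suc k)) (bernstein_poly n k - bernstein_poly n (Suc k)))
     = (\<Sum>k\<le>n. smult (c (Suc k)) (bernstein_poly n k))
        - (\<Sum>k\<le>Suc n. smult (c k) (bernstein_poly n k))"
    unfolding sum.atMost_Suc_shift smult_diff_right sum_subtractf by simp
  also have "\<dots> = (\<Sum>k\<le>n. smult (forward_diff c k) (bernstein_poly n k))"
    by (simp add: bernstein_poly_eq_0 smult_diff_left sum_subtractf)
  finally show ?thesis .
qed

text \<open>Each derivative lowers the degree by one and contributes the old degree as a factor; the
  Pochhammer symbol is the product of the numbers from \<open>n + 1\<close> to \<open>n + a\<close>.
  Writing the degree as \<open>n + a\<close> avoids truncated subtraction.\<close>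

lemma higher_pderiv_bernstein_sum:
  "(pderiv ^^ a) (\<Sum>k\<le>n + a. smult (c k) (bernstein_poly (n + a) k))
    = smult (pochhammer (real n + 1) a) (\<Sum>k\<le>n. smult ((forward_diff ^^ a) c k) (bernstein_poly n k))"
proof (induction a arbitrary: c)
  case (Suc a)
  have "(pderiv ^^ Suc a) (\<Sum>k\<le>n + Suc a. smult (c k) (bernstein_poly (n + Suc a) k))
     = smult (real (Suc (n + a))) (smult (pochhammer (real n + 1) a)
        (\<Sum>k\<le>n. smult ((forward_diff ^^ a) (forward_diff c) k) (bernstein_poly n k)))"
    unfolding funpow_Suc_right o_apply add_Suc_right pderiv_bernstein_sum higher_pderiv_smult Suc.IH ..
  then show ?case
    by (simp add: pochhammer_Suc funpow_swap1 algebra_simps del: funpow.simps add: funpow_Suc_right)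
qed simp

section \<open>Finite differences, spread of the Bernstein weights, and the uniform estimate in one
  variable\<close>

lemma forward_diff_funpow_shift:
  "(forward_diff ^^ a) c (k + j) = (forward_diff ^^ a) (\<lambda>j. c (k + j)) j"
proof (induction a arbitrary: j)
  case (Suc a)
  from Suc[of j] Suc[of "Suc j"] show ?case by simp
qed simp

text \<open>The mean value theorem for differences of order \<open>a\<close>, where
  \<open>\<phi> j\<close> plays the derivative of order \<open>j\<close>. The induction hypothesis
  is applied to the family \<open>\<psi>\<close> of first differences with step \<open>h\<close>;
  one ordinary mean value step on the interval from \<open>\<xi>\<close> to \<open>\<xi> + h\<close>
  then turns \<open>\<psi> a \<xi>\<close> into a value of \<open>\<phi> (Suc a)\<close>.\<close>

lemma forward_diff_mvt:
  assumes "h > 0"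
    and "\<And>j s. j < a \<Longrightarrow> t \<le> s \<Longrightarrow> s \<le> t + real a * h \<Longrightarrow> (\<phi> j has_real_derivative \<phi> (Suc j) s) (at s)"
  shows "\<exists>\<xi>\<ge>t. \<xi> \<le> t + real a * h \<and> (forward_diff ^^ a) (\<lambda>k. \<phi> 0 (t + real k * h)) 0 = h ^ a * \<phi> a \<xi>"
  using assms(2)
proof (induction a arbitrary: \<phi>)
  case (Suc a)
  define \<psi> where "\<psi> j s = \<phi> j (s + h) - \<phi> j s" for j s
  have "(\<psi> j has_real_derivative \<psi> (Suc j) s) (at s)"
    if "j < a" "t \<le> s" "s \<le> t + real a * h" for j s
  proof -
    have "(\<phi> j has_real_derivative \<phi> (Suc j) (s + h)) (at (s + h))"
      "(\<phi> j has_real_derivative \<phi> (Suc j) s) (at s)"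
      using that \<open>h > 0\<close> by (auto intro!: Suc.prems simp: algebra_simps)
    then show ?thesis
      unfolding \<psi>_def by (intro DERIV_diff) (auto simp: DERIV_shift)
  qed
  from Suc.IH[of \<psi>, OF this] obtain \<xi> where \<xi>: "\<xi> \<ge> t" "\<xi> \<le> t + real a * h"
    "(forward_diff ^^ a) (\<lambda>k. \<psi> 0 (t + real k * h)) 0 = h ^ a * \<psi> a \<xi>" by auto
  have "\<exists>z>\<xi>. z < \<xi> + h \<and> \<phi> a (\<xi> + h) - \<phi> a \<xi> = (\<xi> + h - \<xi>) * \<phi> (Suc a) z"
    using \<xi>(1,2) \<open>h > 0\<close> by (intro MVT2 Suc.prems) (auto simp: algebra_simps)
  then obtain z where z: "z > \<xi>" "z < \<xi> + h" "\<psi> a \<xi> = h * \<phi> (Suc a) z"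
    by (auto simp: \<psi>_def)
  have "(forward_diff ^^ Suc a) (\<lambda>k. \<phi> 0 (t + real k * h)) 0 = (forward_diff ^^ a) (\<lambda>k. \<psi> 0 (t + real k * h)) 0"
    unfolding funpow_Suc_right o_apply \<psi>_def by (simp add: algebra_simps)
  also have "\<dots> = h ^ Suc a * \<phi> (Suc a) z"
    using \<xi>(3) z(3) by simp
  finally show ?case
    using \<xi>(1,2) z(1,2) by (intro exI[of _ z]) (auto simp: algebra_simps)
qed auto

text \<open>The variance of a binomial distribution rescaled by \<open>n\<close>. Splitting the
  square into multiples of \<open>k * (k - 1)\<close>, \<open>k\<close> and 1 reduces it to the
  known moments.\<close>

lemma Bernstein_variance:
  assumes "n > 0"
  shows "(\<Sum>k\<le>n. (x - real k / real n)\<^sup>2 * Bernstein n k x) = x * (1 - x) / real n"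
proof -
  have "(real k - real n * x)\<^sup>2 * Bernstein n k x = real k * (real k - 1) * Bernstein n k x
      + (1 - 2 * real n * x) * (real k * Bernstein n k x) + (real n * x)\<^sup>2 * Bernstein n k x" for k
    by (simp add: power2_eq_square algebra_simps)
  then have "(\<Sum>k\<le>n. (real k - real n * x)\<^sup>2 * Bernstein n k x)
      = real n * (real n - 1) * x\<^sup>2 + (1 - 2 * real n * x) * (real n * x) + (real n * x)\<^sup>2"
    by (simp add: sum.distrib flip: sum_distrib_left)
  also have "\<dots> = real n * x * (1 - x)"
    by (simp add: power2_eq_square algebra_simps)
  finally have "(\<Sum>k\<le>n. (real k - real n * x)\<^sup>2 * Bernstein n k x) = real n * x * (1 - x)" .
  then have "(\<Sum>k\<le>n. (real k - real n * x)\<^sup>2 * Bernstein n k x) / (real n)\<^sup>2 = x * (1 - x) / real n"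
    using assms by (simp add: power2_eq_square)
  moreover have "(x - real k / real n)\<^sup>2 = (real k - real n * x)\<^sup>2 / (real n)\<^sup>2" for k
    using assms by (simp add: field_split_simps power2_commute)
  ultimately show ?thesis
    by (simp add: sum_divide_distrib)
qed

text \<open>Chebyshev's device: at distance at least \<open>d\<close> the trivial bound
  \<open>2 * M\<close> is dominated by its multiple with \<open>((s - t) / d)\<^sup>2\<close>. The
  Bernstein average of the resulting quadratic is controlled by the variance.\<close>

lemma modulus_quadratic_bound:
  fixes \<phi> :: "real \<Rightarrow> real"
  assumes "d > 0" "0 \<le> e" "\<bar>\<phi> s\<bar> \<le> M" "\<bar>\<phi> t\<bar> \<le> M" "\<bar>s - t\<bar> < d \<Longrightarrow> \<bar>\<phi> s - \<phi> t\<bar> \<le> e"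
  shows "\<bar>\<phi> s - \<phi> t\<bar> \<le> e + 2 * M / d\<^sup>2 * (s - t)\<^sup>2"
proof (cases "\<bar>s - t\<bar> < d")
  case True
  have "0 \<le> 2 * M / d\<^sup>2 * (s - t)\<^sup>2" using assms(3) by simp
  with assms(5)[OF True] show ?thesis by linarith
next
  case False
  then have "d\<^sup>2 \<le> (s - t)\<^sup>2"
    using assms(1) by (metis abs_le_square_iff abs_of_pos linorder_not_le)
  then have "1 \<le> (s - t)\<^sup>2 / d\<^sup>2" using assms(1) by simp
  then have "2 * M * 1 \<le> 2 * M * ((s - t)\<^sup>2 / d\<^sup>2)"
    using assms(3) by (intro mult_left_mono) auto
  then have "2 * M \<le> 2 * M / d\<^sup>2 * (s - t)\<^sup>2" by simp
  moreover have "\<bar>\<phi> s - \<phi> t\<bar> \<le> 2 * M" using assms(3,4) by linarith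
  ultimately show ?thesis using assms(2) by linarith
qed

text \<open>The factor from lowering the degree \<open>l + a\<close> to \<open>l\<close>, against
  the power of the step size \<open>1 / (l + a)\<close> from the difference quotient: a product of
  \<open>a\<close> factors, each tending to 1.\<close>

lemma tendsto_pochhammer_ratio:
  "(\<lambda>l. pochhammer (real l + 1) a / (real l + real a) ^ a) \<longlonglongrightarrow> 1"
proof -
  have "(\<lambda>l. (real l + 1 + real i) / (real l + real a)) \<longlonglongrightarrow> 1" for i
    by real_asymp
  then have "(\<lambda>l. \<Prod>i<a. (real l + 1 + real i) / (real l + real a)) \<longlonglongrightarrow> (\<Prod>i<a. 1)"
    by (intro tendsto_prod)
  then show ?thesis
    by (simp add: pochhammer_prod prod_dividef atLeast0LessThan)
qed

text \<open>The quantifier order is the point: \<open>n0\<close> is chosen before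
  \<open>\<phi>\<close>, so one degree serves a whole family of functions sharing \<open>M\<close>,
  \<open>d\<close> and \<open>e\<close>. One \<open>e\<close> in the final bound is the modulus of
  continuity, the other absorbs all remaining errors.\<close>

lemma bernstein_deriv_approx:
  assumes "M \<ge> 0" "d > 0" "e > 0"
  shows "\<exists>n0. \<forall>n\<ge>n0. \<forall>\<phi>.
    (\<forall>j<a. \<forall>s\<in>{0..1}. (\<phi> j has_real_derivative \<phi> (Suc j) s) (at s)) \<longrightarrow>
    (\<forall>s\<in>{0..1}. \<bar>\<phi> a s\<bar> \<le> M) \<longrightarrow>
    (\<forall>s\<in>{0..1}. \<forall>t\<in>{0..1}. \<bar>s - t\<bar> < d \<longrightarrow> \<bar>\<phi> a s - \<phi> a t\<bar> \<le> e) \<longrightarrow>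
    (\<forall>x\<in>{0..1}. \<bar>poly ((pderiv ^^ a) (\<Sum>k\<le>n. smult (\<phi> 0 (real k / real n)) (bernstein_poly n k))) x
        - \<phi> a x\<bar> < 2 * e)"
proof -
  define r where "r l = pochhammer (real l + 1) a / (real l + real a) ^ a" for l
  \<comment> \<open>Total error beyond the modulus: \<open>r l\<close> differs from 1, the averaged
    square distance to the nodes is at most \<open>1 / l\<close>, and the intermediate points are
    off the nodes by at most \<open>a / l\<close>.\<close>
  define E where "E l = \<bar>r l - 1\<bar> * M + 2 * M / d\<^sup>2 * (2 / real l + 2 * (real a / real l)\<^sup>2)" for l
  have r: "r \<longlonglongrightarrow> 1"
    unfolding r_def by (rule tendsto_pochhammer_ratio)
  have "(\<lambda>l. 2 / real l + 2 * (real a / real l)\<^sup>2) \<longlonglongrightarrow> 0 + 2 * 0\<^sup>2"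
    by (intro tendsto_intros lim_const_over_n)
  from tendsto_add[OF tendsto_mult_right[OF tendsto_rabs[OF tendsto_diff[OF r tendsto_const]]]
      tendsto_mult_left[OF this]]
  have "E \<longlonglongrightarrow> \<bar>1 - 1\<bar> * M + 2 * M / d\<^sup>2 * (0 + 2 * 0\<^sup>2)"
    unfolding E_def .
  then have "\<forall>\<^sub>F l in sequentially. E l < e"
    using assms(3) by (intro order_tendstoD(2)) auto
  then obtain l0 where l0: "\<And>l. l \<ge> l0 \<Longrightarrow> E l < e"
    by (auto simp: eventually_sequentially)
  show ?thesis
  \<comment> \<open>The \<open>Suc\<close> ensures \<open>l = n - a > 0\<close>, as the nodes
    \<open>k / l\<close> require.\<close>
  proof (intro exI[of _ "Suc l0 + a"] allI impI ballI)
    fix n \<phi> x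
    assume n: "Suc l0 + a \<le> n"
      and der: "\<forall>j<a. \<forall>s\<in>{0..1}. (\<phi> j has_real_derivative \<phi> (Suc j) s) (at s)"
      and M: "\<forall>s\<in>{0..1}. \<bar>\<phi> a s\<bar> \<le> M"
      and mod: "\<forall>s\<in>{0..1}. \<forall>t\<in>{0..1}. \<bar>s - t\<bar> < d \<longrightarrow> \<bar>\<phi> a s - \<phi> a t\<bar> \<le> e"
      and x: "x \<in> {0..1::real}"
    define l where "l = n - a"
    have l: "n = l + a" "l > 0" "l \<ge> l0" using n by (auto simp: l_def)
    define h where "h = 1 / (real l + real a)"
    have h: "h > 0" using l by (simp add: h_def)
    \<comment> \<open>The intermediate point comes from the interval between \<open>k / n\<close>
      and \<open>(k + a) / n\<close>. For \<open>k \<le> l\<close> this interval also contains the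
      node \<open>k / l\<close> of the lower degree, and its length \<open>a / n\<close> is at most
      \<open>a / l\<close>.\<close>
    define good where "good k \<xi> \<longleftrightarrow> \<xi> \<in> {0..1} \<and> \<bar>\<xi> - real k / real l\<bar> \<le> real a / real l \<and>
        (forward_diff ^^ a) (\<lambda>k. \<phi> 0 (real k / real n)) k = h ^ a * \<phi> a \<xi>" for k \<xi>
    have "\<exists>\<xi>. good k \<xi>" if k: "k \<le> l" for k
    proof -
      have le1: "real k * h + real a * h \<le> 1"
        using k l by (simp add: h_def flip: add_divide_distrib)
      have "\<exists>\<xi>\<ge>real k * h. \<xi> \<le> real k * h + real a * h \<and>
          (forward_diff ^^ a) (\<lambda>j. \<phi> 0 (real k * h + real j * h)) 0 = h ^ a * \<phi> a \<xi>"
      proof (rule forward_diff_mvt[OF h])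
        fix j s
        assume j: "j < a" and s: "real k * h \<le> s" "s \<le> real k * h + real a * h"
        have "0 \<le> real k * h" using h by simp
        then have "s \<in> {0..1}" using s le1 by simp
        with der j show "(\<phi> j has_real_derivative \<phi> (Suc j) s) (at s)" by blast
      qed
      then obtain \<xi> where \<xi>: "real k * h \<le> \<xi>" "\<xi> \<le> real k * h + real a * h"
        "(forward_diff ^^ a) (\<lambda>j. \<phi> 0 (real k * h + real j * h)) 0 = h ^ a * \<phi> a \<xi>" by auto
      have "(forward_diff ^^ a) (\<lambda>k. \<phi> 0 (real k / real n)) k
          = (forward_diff ^^ a) (\<lambda>j. \<phi> 0 (real k * h + real j * h)) 0"
        using forward_diff_funpow_shift[of a "\<lambda>k. \<phi> 0 (real k / real n)" k 0]
        by (simp add: h_def l(1) add_divide_distrib)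
      moreover have "0 \<le> \<xi>" "\<xi> \<le> 1"
      proof -
        have "0 \<le> real k * h" using h by simp
        then show "0 \<le> \<xi>" using \<xi>(1) by linarith
        show "\<xi> \<le> 1" using \<xi>(2) le1 by linarith
      qed
      moreover have "\<bar>\<xi> - real k / real l\<bar> \<le> real a / real l"
      proof -
        have "real k * h \<le> real k / real l"
          using l by (auto simp: h_def intro!: divide_left_mono mult_pos_pos)
        moreover have "real a * h \<le> real a / real l"
          using l by (auto simp: h_def intro!: divide_left_mono mult_pos_pos)
        moreover have "real k / real l \<le> real k * h + real a * h"
        proof -
          have "real k * (real l + real a) \<le> (real k + real a) * real l"
            using k by (simp add: algebra_simps mult_left_mono)
          then have "real k / real l \<le> (real k + real a) / (real l + real a)"
            using l by (simp add: divide_le_eq le_divide_eq field_simps)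
          then show ?thesis by (simp add: h_def add_divide_distrib)
        qed
        ultimately show ?thesis using \<xi>(1,2) by linarith
      qed
      ultimately show ?thesis
        unfolding \<xi>(3) good_def by (intro exI[of _ \<xi>] conjI) simp_all
    qed
    then obtain \<xi> where "\<And>k. k \<le> l \<Longrightarrow> good k (\<xi> k)"
      by metis
    then have \<xi>: "\<xi> k \<in> {0..1}" "\<bar>\<xi> k - real k / real l\<bar> \<le> real a / real l"
      "(forward_diff ^^ a) (\<lambda>k. \<phi> 0 (real k / real n)) k = h ^ a * \<phi> a (\<xi> k)" if "k \<le> l" for k
      using that unfolding good_def by blast+
    have rl: "pochhammer (real l + 1) a * h ^ a = r l"
      by (simp add: r_def h_def power_one_over)
    have "poly ((pderiv ^^ a) (\<Sum>k\<le>n. smult (\<phi> 0 (real k / real n)) (bernstein_poly n k))) x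
        = pochhammer (real l + 1) a *
          (\<Sum>k\<le>l. (forward_diff ^^ a) (\<lambda>k. \<phi> 0 (real k / real n)) k * Bernstein l k x)"
      unfolding l(1) higher_pderiv_bernstein_sum by (simp add: poly_sum poly_bernstein_poly)
    also have "\<dots> = (\<Sum>k\<le>l. r l * \<phi> a (\<xi> k) * Bernstein l k x)"
      unfolding sum_distrib_left rl[symmetric]
      by (intro sum.cong refl) (simp add: \<xi>(3) mult_ac)
    finally have eq: "poly ((pderiv ^^ a) (\<Sum>k\<le>n. smult (\<phi> 0 (real k / real n)) (bernstein_poly n k))) x
        - \<phi> a x = (\<Sum>k\<le>l. (r l * \<phi> a (\<xi> k) - \<phi> a x) * Bernstein l k x)"
      by (simp add: left_diff_distrib sum_subtractf flip: sum_distrib_left)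
    let ?C = "\<bar>r l - 1\<bar> * M + e + 2 * M / d\<^sup>2 * (2 * (real a / real l)\<^sup>2)"
    have bound: "\<bar>r l * \<phi> a (\<xi> k) - \<phi> a x\<bar>
        \<le> ?C + 4 * M / d\<^sup>2 * (x - real k / real l)\<^sup>2" if k: "k \<le> l" for k
    proof -
      have "\<bar>(r l - 1) * \<phi> a (\<xi> k)\<bar> \<le> \<bar>r l - 1\<bar> * M"
        unfolding abs_mult using M \<xi>(1)[OF k] by (intro mult_left_mono) auto
      moreover have "\<bar>\<phi> a (\<xi> k) - \<phi> a x\<bar> \<le> e + 2 * M / d\<^sup>2 * (\<xi> k - x)\<^sup>2"
        using assms M mod \<xi>(1)[OF k] x by (intro modulus_quadratic_bound) auto
      moreover have "(\<xi> k - x)\<^sup>2 \<le> 2 * (real a / real l)\<^sup>2 + 2 * (x - real k / real l)\<^sup>2"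
      proof -
        have "(\<xi> k - real k / real l)\<^sup>2 \<le> (real a / real l)\<^sup>2"
          using \<xi>(2)[OF k] by (metis abs_ge_zero power2_abs power_mono)
        \<comment> \<open>The right-hand side minus the left-hand side is exactly the square of the
          sum of the two differences.\<close>
        moreover have "(\<xi> k - x)\<^sup>2 \<le> 2 * (\<xi> k - real k / real l)\<^sup>2 + 2 * (x - real k / real l)\<^sup>2"
          using zero_le_power2[of "\<xi> k - real k / real l + (x - real k / real l)"]
          by (simp add: power2_eq_square algebra_simps add_divide_distrib)
        ultimately show ?thesis by linarith
      qed
      then have "2 * M / d\<^sup>2 * (\<xi> k - x)\<^sup>2
          \<le> 2 * M / d\<^sup>2 * (2 * (real a / real l)\<^sup>2 + 2 * (x - real k / real l)\<^sup>2)"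
        using assms by (intro mult_left_mono) auto
      moreover have "r l * \<phi> a (\<xi> k) - \<phi> a x = (r l - 1) * \<phi> a (\<xi> k) + (\<phi> a (\<xi> k) - \<phi> a x)"
        by (simp add: algebra_simps)
      ultimately show ?thesis
        by (simp add: distrib_left)
    qed
    have "\<bar>\<Sum>k\<le>l. (r l * \<phi> a (\<xi> k) - \<phi> a x) * Bernstein l k x\<bar>
        \<le> (\<Sum>k\<le>l. (?C + 4 * M / d\<^sup>2 * (x - real k / real l)\<^sup>2) * Bernstein l k x)"
    proof (rule order_trans[OF sum_abs sum_mono])
      fix k assume "k \<in> {..l}"
      moreover have "Bernstein l k x \<ge> 0" using x by (simp add: Bernstein_nonneg)
      ultimately show "\<bar>(r l * \<phi> a (\<xi> k) - \<phi> a x) * Bernstein l k x\<bar>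
          \<le> (?C + 4 * M / d\<^sup>2 * (x - real k / real l)\<^sup>2) * Bernstein l k x"
        using bound[of k] by (simp only: abs_mult abs_of_nonneg atMost_iff mult_right_mono)
    qed
    also have "\<dots> = ?C + 4 * M / d\<^sup>2 * (x * (1 - x) / real l)"
      by (simp only: distrib_right[of _ _ "Bernstein _ _ _"] sum.distrib mult.assoc Bernstein_variance[OF l(2)]
          flip: sum_distrib_left) simp
    also have "\<dots> \<le> ?C + 4 * M / d\<^sup>2 * (1 / real l)"
      using x assms by (intro add_left_mono mult_left_mono divide_right_mono mult_le_one) auto
    also have "\<dots> = e + E l"
      by (simp add: E_def distrib_left)
    also have "\<dots> < 2 * e" using l0[OF l(3)] by simp
    finally show "\<bar>poly ((pderiv ^^ a) (\<Sum>k\<le>n. smult (\<phi> 0 (real k / real n)) (bernstein_poly n k))) x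
        - \<phi> a x\<bar> < 2 * e"
      unfolding eq .
  qed
qed

subsection \<open>Bernstein operators in one coordinate\<close>

definition replace_coord :: "'n \<Rightarrow> real \<Rightarrow> real ^ 'n \<Rightarrow> real ^ 'n" where
  "replace_coord i t x = (\<chi> j. if j = i then t else x $ j)"

lemma replace_coord_nth: "replace_coord i t x $ j = (if j = i then t else x $ j)"
  by (simp add: replace_coord_def)

lemma replace_coord_self [simp]: "replace_coord i (x $ i) x = x"
  by (simp add: vec_eq_iff replace_coord_nth)

lemma replace_coord_add_axis: "replace_coord i t x = replace_coord i 0 x + t *\<^sub>R axis i 1"
  by (simp add: vec_eq_iff replace_coord_nth axis_def)

lemma dist_replace_coord: "dist (replace_coord i s x) (replace_coord i t x) = \<bar>s - t\<bar>"
proof -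
  have "replace_coord i s x - replace_coord i t x = (s - t) *\<^sub>R axis i 1"
    by (simp add: vec_eq_iff replace_coord_nth axis_def)
  then show ?thesis by (simp add: dist_norm)
qed

lemma continuous_on_replace_coord [continuous_intros]: "continuous_on S (replace_coord i t)"
proof -
  have "continuous_on S (\<lambda>x. if j = i then t else x $ j)" for j
    by (cases "j = i") (auto intro: continuous_intros)
  then show ?thesis
    unfolding replace_coord_def by (intro continuous_on_vec_lambda)
qed

lemma partial_deriv_replace_coord:
  assumes "partial_differentiable_at i f (replace_coord i t x)"
  shows "((\<lambda>s. f (replace_coord i s x)) has_real_derivative partial_deriv i f (replace_coord i t x)) (at t)"
  using assms partial_deriv_line[of i f "replace_coord i 0 x" t]
  by (simp flip: replace_coord_add_axis)

text \<open>Arbitrary nodes \<open>\<tau>\<close> and polynomials \<open>q\<close> make the class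
  closed under differentiation: a derivative changes either \<open>q\<close> or \<open>f\<close> and
  leaves the shape intact.\<close>

definition coord_op ::
    "'n \<Rightarrow> nat \<Rightarrow> (nat \<Rightarrow> real) \<Rightarrow> (nat \<Rightarrow> real poly) \<Rightarrow> (real ^ 'n \<Rightarrow> real) \<Rightarrow> real ^ 'n \<Rightarrow> real" where
  "coord_op i n \<tau> q f x = (\<Sum>k\<le>n. f (replace_coord i (\<tau> k) x) * poly (q k) (x $ i))"

text \<open>The points where \<open>f\<close> is sampled do not move along axis \<open>i\<close>, so
  only the polynomial factors vary.\<close>

lemma coord_op_partial_deriv_same:
  fixes f :: "real ^ 'n \<Rightarrow> real"
  shows "((\<lambda>t. coord_op i n \<tau> q f (x + t *\<^sub>R axis i 1)) has_real_derivative
      coord_op i n \<tau> (\<lambda>k. pderiv (q k)) f x) (at 0)"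
proof -
  have "replace_coord i s (x + t *\<^sub>R axis i 1) = replace_coord i s x" for s t
    by (simp add: vec_eq_iff replace_coord_nth axis_def)
  moreover have "((\<lambda>t. poly (q k) (x $ i + t)) has_real_derivative poly (pderiv (q k)) (x $ i)) (at 0)" for k
    using poly_DERIV[of "q k" "x $ i"] DERIV_shift[of "poly (q k)" "poly (pderiv (q k)) (x $ i)" 0 "x $ i"]
    by (simp add: add.commute)
  ultimately show ?thesis
    unfolding coord_op_def by (auto intro!: DERIV_sum DERIV_cmult)
qed

text \<open>Replacing coordinate \<open>i\<close> commutes with translation along another axis, and
  the polynomial factors stay constant on that axis.\<close>

lemma coord_op_partial_deriv_other:
  fixes f :: "real ^ 'n \<Rightarrow> real"
  assumes "j \<noteq> i" "\<And>k. k \<le> n \<Longrightarrow> partial_differentiable_at j f (replace_coord i (\<tau> k) x)"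
  shows "((\<lambda>t. coord_op i n \<tau> q f (x + t *\<^sub>R axis j 1)) has_real_derivative
      coord_op i n \<tau> q (partial_deriv j f) x) (at 0)"
proof -
  have "replace_coord i s (x + t *\<^sub>R axis j 1) = replace_coord i s x + t *\<^sub>R axis j 1" for s t
    using assms(1) by (simp add: vec_eq_iff replace_coord_nth axis_def)
  moreover have "(x + t *\<^sub>R axis j 1) $ i = x $ i" for t
    using assms(1) by (simp add: axis_def)
  ultimately have eq: "coord_op i n \<tau> q f (x + t *\<^sub>R axis j 1)
      = (\<Sum>k\<le>n. f (replace_coord i (\<tau> k) x + t *\<^sub>R axis j 1) * poly (q k) (x $ i))" for t
    by (simp only: coord_op_def)
  show ?thesis
    unfolding eq unfolding coord_op_def
    by (auto intro!: DERIV_sum DERIV_cmult_right has_partial_deriv assms(2))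
qed

text \<open>An open domain on which the operators act: it contains every point where they sample
  \<open>f\<close>, so a function of class C^m on \<open>U\<close> is mapped to one on the same
  \<open>U\<close>.\<close>

locale coord_stable =
  fixes U :: "(real ^ 'n) set"
  assumes open_U: "open U"
    and replace_coord_mem: "x \<in> U \<Longrightarrow> 0 \<le> t \<Longrightarrow> t \<le> 1 \<Longrightarrow> replace_coord i t x \<in> U"
    and unit_cube_subset: "unit_cube \<subseteq> U"
begin

lemma continuous_on_coord_op:
  assumes "\<And>k. k \<le> n \<Longrightarrow> \<tau> k \<in> {0..1}" "continuous_on U f"
  shows "continuous_on U (coord_op i n \<tau> q f)"
proof -
  have "continuous_on U (\<lambda>x. f (replace_coord i (\<tau> k) x))" if "k \<le> n" for k
    by (rule continuous_on_compose2[OF assms(2) continuous_on_replace_coord])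
      (use assms(1)[OF that] replace_coord_mem in auto)
  then show ?thesis
    unfolding coord_op_def by (auto intro!: continuous_intros)
qed

text \<open>The induction keeps both \<open>f\<close> and \<open>q\<close> arbitrary: a derivative
  along \<open>i\<close> keeps \<open>f\<close> and passes to \<open>pderiv (q k)\<close>, any other
  keeps \<open>q\<close> and passes to a derivative of \<open>f\<close>.\<close>

lemma times_cont_diff_on_coord_op:
  assumes \<tau>: "\<And>k. k \<le> n \<Longrightarrow> \<tau> k \<in> {0..1}" and f: "times_cont_diff_on m U f"
  shows "times_cont_diff_on m U (coord_op i n \<tau> q f)"
  using f
proof (induction m arbitrary: f q)
  case 0
  then show ?case using continuous_on_coord_op[OF \<tau>] by simp
next
  case (Suc m)
  have cont: "continuous_on U f" and diff: "\<And>j x. x \<in> U \<Longrightarrow> partial_differentiable_at j f x"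
    and smooth: "\<And>j. times_cont_diff_on m U (partial_deriv j f)"
    using Suc.prems by simp_all
  have f': "times_cont_diff_on m U f"
    by (rule times_cont_diff_on_mono[OF Suc.prems]) simp
  have "(\<forall>x\<in>U. partial_differentiable_at j (coord_op i n \<tau> q f) x) \<and>
      times_cont_diff_on m U (partial_deriv j (coord_op i n \<tau> q f))" for j
  proof (cases "j = i")
    case True
    note D = coord_op_partial_deriv_same[of i n \<tau> q f]
    show ?thesis
      unfolding True
      using partial_derivI(1)[OF D]
        times_cont_diff_on_cong[OF open_U partial_derivI(2)[OF D, symmetric] Suc.IH[OF f', of "\<lambda>k. pderiv (q k)"]]
      by blast
  next
    case False
    have D: "((\<lambda>t. coord_op i n \<tau> q f (x + t *\<^sub>R axis j 1)) has_real_derivative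
      coord_op i n \<tau> q (partial_deriv j f) x) (at 0)" if "x \<in> U" for x
      by (rule coord_op_partial_deriv_other[OF False diff])
        (use \<tau> replace_coord_mem that in auto)
    show ?thesis
      using partial_derivI(1)[OF D]
        times_cont_diff_on_cong[OF open_U partial_derivI(2)[OF D, symmetric] Suc.IH[OF smooth]]
      by blast
  qed
  then show ?case
    using continuous_on_coord_op[OF \<tau> cont] by simp
qed

text \<open>The word is processed letter by letter without reordering, since each letter acts on one
  factor only and produces an operator of the same form.\<close>

lemma iter_deriv_coord_op:
  assumes \<tau>: "\<And>k. k \<le> n \<Longrightarrow> \<tau> k \<in> {0..1}" and f: "times_cont_diff_on m U f"
    and "length w \<le> m" "x \<in> U"
  shows "iter_deriv w (coord_op i n \<tau> q f) x
    = coord_op i n \<tau> (\<lambda>k. (pderiv ^^ count_list w i) (q k)) (iter_deriv (filter (\<lambda>j. j \<noteq> i) w) f) x"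
  using assms(3,4)
proof (induction w arbitrary: x)
  case (Cons j w)
  let ?h = "iter_deriv (filter (\<lambda>j. j \<noteq> i) w) f" and ?q = "\<lambda>k. (pderiv ^^ count_list w i) (q k)"
  have eq: "iter_deriv (j # w) (coord_op i n \<tau> q f) x = partial_deriv j (coord_op i n \<tau> ?q ?h) x"
    unfolding foldr_Cons o_apply
    by (rule partial_cong(1)[OF open_U Cons.prems(2) Cons.IH]) (use Cons.prems in auto)
  show ?case
  proof (cases "j = i")
    case True
    show ?thesis
      unfolding eq using partial_derivI(2)[OF coord_op_partial_deriv_same] True by simp
  next
    case False
    have "partial_differentiable_at j ?h (replace_coord i (\<tau> k) x)" if "k \<le> n" for k
    proof (rule iter_deriv_differentiable[OF f])
      show "length (filter (\<lambda>j. j \<noteq> i) w) < m"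
        using Cons.prems(1) length_filter_le[of "\<lambda>j. j \<noteq> i" w] by (simp del: length_filter_le)
      show "replace_coord i (\<tau> k) x \<in> U"
        using \<tau>[OF that] Cons.prems(2) by (auto intro: replace_coord_mem)
    qed
    from partial_derivI(2)[OF coord_op_partial_deriv_other[OF False this]]
    show ?thesis unfolding eq using False by simp
  qed
qed simp

definition bernstein_op :: "'n \<Rightarrow> nat \<Rightarrow> (real ^ 'n \<Rightarrow> real) \<Rightarrow> real ^ 'n \<Rightarrow> real" where
  "bernstein_op i n = coord_op i n (\<lambda>k. real k / real n) (bernstein_poly n)"

text \<open>The bound \<open>M\<close> and the modulus \<open>d\<close> are those of the single
  function \<open>F\<close> on the compact cube, so they hold on every line parallel to axis
  \<open>i\<close> and the degree is independent of \<open>x\<close>.\<close>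

lemma bernstein_op_converges_deriv:
  assumes f: "times_cont_diff_on m U f" and w: "length w \<le> m" and "e > 0"
  shows "\<forall>\<^sub>F n in sequentially. \<forall>x\<in>unit_cube.
    \<bar>iter_deriv w (bernstein_op i n f) x - iter_deriv w f x\<bar> < e"
proof -
  define F where "F = iter_deriv w f"
  define v where "v = filter (\<lambda>j. j \<noteq> i) w"
  define a where "a = count_list w i"
  have len: "length v + a = length w"
    unfolding v_def a_def by (induction w) auto
  have F: "continuous_on unit_cube F"
    unfolding F_def
    by (rule continuous_on_subset[OF iter_deriv_continuous[OF f w] unit_cube_subset])
  have cube: "compact (unit_cube :: (real ^ 'n) set)"
    by (simp add: unit_cube_def)
  have upd_cube: "replace_coord i t x \<in> unit_cube" if "x \<in> unit_cube" "t \<in> {0..1}" for t x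
    using that by (auto simp: unit_cube_def mem_box_cart replace_coord_nth)
  obtain M where M: "\<And>x. x \<in> unit_cube \<Longrightarrow> \<bar>F x\<bar> \<le> M"
    using compact_imp_bounded[OF compact_continuous_image[OF F cube]] by (auto simp: bounded_iff)
  have "(0 :: real ^ 'n) \<in> unit_cube" by (simp add: unit_cube_def mem_box_cart)
  from M[OF this] have M0: "M \<ge> 0" by linarith
  have "e / 2 > 0" using \<open>e > 0\<close> by simp
  then obtain d where d: "d > 0"
    "\<And>x y. x \<in> unit_cube \<Longrightarrow> y \<in> unit_cube \<Longrightarrow> dist x y < d \<Longrightarrow> dist (F x) (F y) < e / 2"
    by (rule uniformly_continuous_onE[OF compact_uniformly_continuous[OF F cube]]) (metis dist_commute)
  obtain n0 where n0: "\<forall>n\<ge>n0. \<forall>\<phi>.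
    (\<forall>j<a. \<forall>s\<in>{0..1}. (\<phi> j has_real_derivative \<phi> (Suc j) s) (at s)) \<longrightarrow>
    (\<forall>s\<in>{0..1}. \<bar>\<phi> a s\<bar> \<le> M) \<longrightarrow>
    (\<forall>s\<in>{0..1}. \<forall>t\<in>{0..1}. \<bar>s - t\<bar> < d \<longrightarrow> \<bar>\<phi> a s - \<phi> a t\<bar> \<le> e / 2) \<longrightarrow>
    (\<forall>x\<in>{0..1}. \<bar>poly ((pderiv ^^ a) (\<Sum>k\<le>n. smult (\<phi> 0 (real k / real n)) (bernstein_poly n k))) x
        - \<phi> a x\<bar> < 2 * (e / 2))"
    using bernstein_deriv_approx[OF M0 d(1) half_gt_zero[OF \<open>e > 0\<close>], of a] by (elim exE)
  show ?thesis
    unfolding eventually_sequentially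
  proof (intro exI[of _ n0] allI impI ballI)
    fix n and x :: "real ^ 'n"
    assume n: "n0 \<le> n" and x: "x \<in> unit_cube"
    \<comment> \<open>The restriction to the line through \<open>x\<close> parallel to axis
      \<open>i\<close>: \<open>\<phi> 0\<close> supplies the sampled values of
      \<open>iter_deriv v f\<close>, and \<open>\<phi> a\<close> is \<open>F\<close> on that line
      once the letters \<open>i\<close> are collected.\<close>
    define \<phi> where "\<phi> j t = iter_deriv (replicate j i @ v) f (replace_coord i t x)" for j t
    have xU: "x \<in> U" using x unit_cube_subset by blast
    \<comment> \<open>For \<open>n = 0\<close> the only node is \<open>0 / 0 = 0\<close>, which also
      lies in the interval.\<close>
    have node: "real k / real n \<in> {0..1}" if "k \<le> n" for k
      using that by (auto simp: divide_le_eq)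
    have \<phi>a: "\<phi> a t = F (replace_coord i t x)" if "t \<in> {0..1}" for t
    proof -
      have "replace_coord i t x \<in> U" using upd_cube[OF x that] unit_cube_subset by blast
      from iter_deriv_collect[OF open_U f w this, of i] show ?thesis
        by (simp add: \<phi>_def F_def a_def v_def foldr_replicate)
    qed
    have "\<bar>poly ((pderiv ^^ a) (\<Sum>k\<le>n. smult (\<phi> 0 (real k / real n)) (bernstein_poly n k))) (x $ i)
        - \<phi> a (x $ i)\<bar> < 2 * (e / 2)"
    proof (rule n0[rule_format, OF n, where \<phi> = \<phi> and x = "x $ i"])
      show "x $ i \<in> {0..1}" using x by (auto simp: unit_cube_def mem_box_cart)
    next
      fix s :: real assume "s \<in> {0..1}"
      then show "\<bar>\<phi> a s\<bar> \<le> M" using \<phi>a M upd_cube[OF x] by simp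
    next
      fix s t :: real assume "s \<in> {0..1}" "t \<in> {0..1}" "\<bar>s - t\<bar> < d"
      then show "\<bar>\<phi> a s - \<phi> a t\<bar> \<le> e / 2"
        using d(2)[OF upd_cube[OF x] upd_cube[OF x], of s t] \<phi>a
        by (simp add: dist_replace_coord dist_real_def)
    next
      fix j and s :: real assume j: "j < a" and s: "s \<in> {0..1}"
      have "replace_coord i s x \<in> U" using upd_cube[OF x s] unit_cube_subset by blast
      then have "partial_differentiable_at i (iter_deriv (replicate j i @ v) f) (replace_coord i s x)"
        using len j w by (intro iter_deriv_differentiable[OF f]) auto
      from partial_deriv_replace_coord[OF this]
      show "(\<phi> j has_real_derivative \<phi> (Suc j) s) (at s)"
        by (simp add: \<phi>_def[abs_def])
    qed
    moreover have "poly ((pderiv ^^ a) (\<Sum>k\<le>n. smult (\<phi> 0 (real k / real n)) (bernstein_poly n k))) (x $ i)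
        = iter_deriv w (bernstein_op i n f) x"
    proof -
      have "iter_deriv w (bernstein_op i n f) x = coord_op i n (\<lambda>k. real k / real n)
          (\<lambda>k. (pderiv ^^ a) (bernstein_poly n k)) (iter_deriv v f) x"
        unfolding bernstein_op_def a_def v_def
        by (rule iter_deriv_coord_op[OF _ f w xU]) (rule node)
      then show ?thesis
        by (simp add: coord_op_def higher_pderiv_sum higher_pderiv_smult poly_sum \<phi>_def)
    qed
    moreover have "\<phi> a (x $ i) = F x"
      using \<phi>a[of "x $ i"] x by (simp add: unit_cube_def mem_box_cart)
    ultimately show "\<bar>iter_deriv w (bernstein_op i n f) x - iter_deriv w f x\<bar> < e"
      by (simp add: F_def)
  qed
qed

text \<open>There are only finitely many words of length at most \<open>m\<close>, so one degree
  works for all of them.\<close>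

lemma bernstein_op_approx:
  assumes f: "times_cont_diff_on m U f" and "e > 0"
  shows "\<exists>n. \<forall>w. length w \<le> m \<longrightarrow> (\<forall>x\<in>unit_cube.
    \<bar>iter_deriv w (bernstein_op i n f) x - iter_deriv w f x\<bar> < e)"
proof -
  have "finite {w :: 'n list. length w \<le> m}"
    using finite_lists_length_le[of "UNIV :: 'n set" m] by simp
  then have "\<forall>\<^sub>F n in sequentially. \<forall>w\<in>{w. length w \<le> m}. \<forall>x\<in>unit_cube.
    \<bar>iter_deriv w (bernstein_op i n f) x - iter_deriv w f x\<bar> < e"
    using bernstein_op_converges_deriv[OF f _ \<open>e > 0\<close>] by (intro eventually_ball_finite) auto
  from eventually_happens[OF this] show ?thesis by auto
qed

end

text \<open>The coordinates outside \<open>S\<close> are frozen at those of \<open>z\<close>, and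
  the dependence on \<open>z\<close> is left arbitrary. For empty \<open>S\<close> this holds for
  every function; for \<open>S = UNIV\<close> it says that \<open>g\<close> itself is a
  polynomial.\<close>

definition polynomial_in_coords :: "'n set \<Rightarrow> (real ^ 'n \<Rightarrow> real) \<Rightarrow> bool" where
  "polynomial_in_coords S g \<longleftrightarrow>
    (\<forall>z. real_polynomial_function (\<lambda>x. g (\<chi> j. if j \<in> S then x $ j else z $ j)))"

lemma real_polynomial_function_poly_nth:
  "real_polynomial_function (\<lambda>x :: real ^ 'n. poly p (x $ i))"
proof (induction p)
  case (pCons a p)
  show ?case
    unfolding poly_pCons
    by (intro real_polynomial_function.intros bounded_linear_vec_nth pCons.IH)
qed (simp add: real_polynomial_function.intros(2))

lemma polynomial_in_coords_coord_op:
  assumes "polynomial_in_coords S g" "i \<notin> S"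
  shows "polynomial_in_coords (insert i S) (coord_op i n \<tau> q g)"
  unfolding polynomial_in_coords_def
proof
  fix z
  have "replace_coord i t (\<chi> j. if j \<in> insert i S then x $ j else z $ j)
      = (\<chi> j. if j \<in> S then x $ j else replace_coord i t z $ j)" for t x
    using assms(2) by (auto simp: vec_eq_iff replace_coord_nth)
  moreover have "real_polynomial_function (\<lambda>x. g (\<chi> j. if j \<in> S then x $ j else replace_coord i t z $ j))" for t
    using assms(1) by (simp add: polynomial_in_coords_def)
  ultimately show "real_polynomial_function
      (\<lambda>x. coord_op i n \<tau> q g (\<chi> j. if j \<in> insert i S then x $ j else z $ j))"
    unfolding coord_op_def
    by (auto intro!: real_polynomial_function_sum real_polynomial_function.intros(4)
        real_polynomial_function_poly_nth)
qed

context coord_stable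
begin

text \<open>The degree for the new coordinate is chosen after \<open>g\<close>, to approximate
  \<open>g\<close> rather than \<open>f\<close>; half of the tolerance goes to each of the two
  approximations.\<close>

lemma polynomial_in_coords_approx:
  assumes f: "times_cont_diff_on m U f" and "finite S" "e > 0"
  shows "\<exists>g. times_cont_diff_on m U g \<and> polynomial_in_coords S g \<and>
    (\<forall>w. length w \<le> m \<longrightarrow> (\<forall>x\<in>unit_cube. \<bar>iter_deriv w g x - iter_deriv w f x\<bar> < e))"
  using assms(2,3)
proof (induction S arbitrary: e rule: finite_induct)
  case empty
  have "polynomial_in_coords {} f"
    by (simp add: polynomial_in_coords_def real_polynomial_function.intros(2))
  with f empty show ?case by (intro exI[of _ f]) auto
next
  case (insert i S)
  have "e / 2 > 0" using insert.prems by simp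
  from insert.IH[OF this] obtain g where g: "times_cont_diff_on m U g" "polynomial_in_coords S g"
    "\<And>w x. length w \<le> m \<Longrightarrow> x \<in> unit_cube \<Longrightarrow> \<bar>iter_deriv w g x - iter_deriv w f x\<bar> < e / 2"
    by blast
  from bernstein_op_approx[OF g(1) \<open>e / 2 > 0\<close>, of i] obtain n where n:
    "\<And>w x. length w \<le> m \<Longrightarrow> x \<in> unit_cube \<Longrightarrow>
      \<bar>iter_deriv w (bernstein_op i n g) x - iter_deriv w g x\<bar> < e / 2"
    by blast
  show ?case
  proof (intro exI[of _ "bernstein_op i n g"] conjI allI impI ballI)
    show "times_cont_diff_on m U (bernstein_op i n g)"
      unfolding bernstein_op_def
      by (rule times_cont_diff_on_coord_op[OF _ g(1)]) (auto simp: divide_le_eq)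
    show "polynomial_in_coords (insert i S) (bernstein_op i n g)"
      unfolding bernstein_op_def by (rule polynomial_in_coords_coord_op[OF g(2) insert.hyps(2)])
    show "\<bar>iter_deriv w (bernstein_op i n g) x - iter_deriv w f x\<bar> < e"
      if "length w \<le> m" "x \<in> unit_cube" for w x
      using g(3)[OF that] n[OF that] by linarith
  qed
qed

lemma polynomial_approx:
  assumes "times_cont_diff_on m U f" "e > 0"
  shows "\<exists>P. real_polynomial_function P \<and> times_cont_diff_on m U P \<and>
    (\<forall>w. length w \<le> m \<longrightarrow> (\<forall>x\<in>unit_cube. \<bar>iter_deriv w P x - iter_deriv w f x\<bar> < e))"
  using polynomial_in_coords_approx[OF assms(1) finite[of UNIV] assms(2)]
  by (auto simp: polynomial_in_coords_def)

end

subsection \<open>Dilations and the Sobolev norm\<close>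

lemma times_cont_diff_on_subset:
  "times_cont_diff_on m U f \<Longrightarrow> V \<subseteq> U \<Longrightarrow> times_cont_diff_on m V f"
  by (induction m arbitrary: f) (auto intro: continuous_on_subset)

lemma partial_deriv_dilate:
  assumes "partial_differentiable_at i f (b + l *\<^sub>R x)"
  shows "((\<lambda>t. r * f (b + l *\<^sub>R (x + t *\<^sub>R axis i 1))) has_real_derivative
    r * l * partial_deriv i f (b + l *\<^sub>R x)) (at 0)"
proof -
  have "((\<lambda>t. f (b + l *\<^sub>R x + t *\<^sub>R axis i 1)) has_real_derivative partial_deriv i f (b + l *\<^sub>R x)) (at (l * 0))"
    using has_partial_deriv[OF assms] by simp
  moreover have "((\<lambda>t. l * t) has_real_derivative l) (at 0)"
    by (auto intro!: derivative_eq_intros)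
  ultimately have "((\<lambda>t. f (b + l *\<^sub>R x + (l * t) *\<^sub>R axis i 1)) has_real_derivative
      partial_deriv i f (b + l *\<^sub>R x) * l) (at 0)"
    by (rule DERIV_chain2)
  from DERIV_cmult[OF this, of r] show ?thesis
    by (simp add: scaleR_add_right mult_ac add.assoc)
qed

text \<open>The factor \<open>r\<close> closes the induction: a derivative of the dilated function
  has the same form with \<open>r * l\<close> for \<open>r\<close>.\<close>

lemma times_cont_diff_on_dilate:
  fixes f :: "real ^ 'n \<Rightarrow> real"
  assumes W: "open W" "\<And>x. x \<in> W \<Longrightarrow> b + l *\<^sub>R x \<in> V" and "times_cont_diff_on m V f"
  shows "times_cont_diff_on m W (\<lambda>x. r * f (b + l *\<^sub>R x))"
  using assms(3)
proof (induction m arbitrary: f r)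
  case 0
  have "continuous_on W (\<lambda>x. f (b + l *\<^sub>R x))"
    by (rule continuous_on_compose2[of V f]) (use 0 W in \<open>auto intro!: continuous_intros\<close>)
  then show ?case by (auto intro!: continuous_intros)
next
  case (Suc m)
  have cont: "continuous_on V f" and diff: "\<And>j x. x \<in> V \<Longrightarrow> partial_differentiable_at j f x"
    and smooth: "\<And>j. times_cont_diff_on m V (partial_deriv j f)"
    using Suc.prems by simp_all
  have "continuous_on W (\<lambda>x. f (b + l *\<^sub>R x))"
    by (rule continuous_on_compose2[OF cont]) (use W in \<open>auto intro!: continuous_intros\<close>)
  then have "continuous_on W (\<lambda>x. r * f (b + l *\<^sub>R x))"
    by (auto intro!: continuous_intros)
  moreover have "partial_differentiable_at j (\<lambda>x. r * f (b + l *\<^sub>R x)) x" if "x \<in> W" for j x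
    by (rule partial_derivI(1)[OF partial_deriv_dilate[OF diff[OF W(2)[OF that]]]])
  moreover have "times_cont_diff_on m W (partial_deriv j (\<lambda>x. r * f (b + l *\<^sub>R x)))" for j
  proof (rule times_cont_diff_on_cong[OF W(1) _ Suc.IH[OF smooth]])
    show "r * l * partial_deriv j f (b + l *\<^sub>R x) = partial_deriv j (\<lambda>x. r * f (b + l *\<^sub>R x)) x"
      if "x \<in> W" for x
      by (rule partial_derivI(2)[OF partial_deriv_dilate[OF diff[OF W(2)[OF that]]], symmetric])
  qed
  ultimately show ?case by simp
qed

lemma iter_deriv_dilate:
  fixes f :: "real ^ 'n \<Rightarrow> real"
  assumes W: "open W" "\<And>x. x \<in> W \<Longrightarrow> b + l *\<^sub>R x \<in> V" and f: "times_cont_diff_on m V f"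
    and "length w \<le> m" "x \<in> W"
  shows "iter_deriv w (\<lambda>x. f (b + l *\<^sub>R x)) x = l ^ length w * iter_deriv w f (b + l *\<^sub>R x)"
  using assms(4,5)
proof (induction w arbitrary: x)
  case (Cons j w)
  have "iter_deriv (j # w) (\<lambda>x. f (b + l *\<^sub>R x)) x
      = partial_deriv j (\<lambda>x. l ^ length w * iter_deriv w f (b + l *\<^sub>R x)) x"
    unfolding foldr_Cons o_apply
    by (rule partial_cong(1)[OF W(1) Cons.prems(2) Cons.IH]) (use Cons.prems in auto)
  also have "\<dots> = l ^ length w * l * partial_deriv j (iter_deriv w f) (b + l *\<^sub>R x)"
    using Cons.prems W(2)
    by (intro partial_derivI(2) partial_deriv_dilate iter_deriv_differentiable[OF f]) auto
  finally show ?case by simp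
qed simp

text \<open>Uniform continuity in \<open>l\<close> and \<open>x\<close> jointly: \<open>H\<close> is
  continuous on a compact product and \<open>H (1, x) = G x\<close>. The map inside \<open>G\<close>
  is the dilation about the centre of the cube, and \<open>l ^ k\<close> is the chain rule factor of
  a derivative of order \<open>k\<close>.\<close>

lemma dilation_close:
  fixes G :: "real ^ 'n \<Rightarrow> real"
  assumes G: "continuous_on unit_cube G" and "e > 0"
  shows "\<forall>\<^sub>F l in at_left 1. \<forall>x\<in>unit_cube. \<bar>l ^ k * G (((1 - l) / 2) *\<^sub>R 1 + l *\<^sub>R x) - G x\<bar> < e"
proof -
  define K where "K = {0..1::real} \<times> (unit_cube :: (real ^ 'n) set)"
  define H where "H p = fst p ^ k * G (((1 - fst p) / 2) *\<^sub>R 1 + fst p *\<^sub>R snd p)" for p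
  have mem: "((1 - l) / 2) *\<^sub>R 1 + l *\<^sub>R x \<in> unit_cube"
    if "l \<in> {0..1}" "x \<in> unit_cube" for l and x :: "real ^ 'n"
  proof -
    have "0 \<le> l * (x $ i)" "l * (x $ i) \<le> l" for i
      using that by (auto simp: unit_cube_def mem_box_cart mult_left_le)
    moreover have "0 \<le> (1 - l) / 2" "(1 - l) / 2 + l \<le> 1" using that by (auto simp: field_simps)
    ultimately show ?thesis
      unfolding unit_cube_def mem_box_cart by (auto intro: add_nonneg_nonneg order_trans[OF add_left_mono])
  qed
  have "continuous_on K (\<lambda>p. G (((1 - fst p) / 2) *\<^sub>R 1 + fst p *\<^sub>R snd p))"
    by (rule continuous_on_compose2[OF G]) (auto simp: K_def intro!: continuous_intros mem)
  then have "continuous_on K H"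
    unfolding H_def by (intro continuous_intros)
  moreover have "compact K"
    unfolding K_def by (intro compact_Times) (auto simp: unit_cube_def)
  ultimately have "uniformly_continuous_on K H"
    by (rule compact_uniformly_continuous)
  then obtain d where d: "d > 0"
    "\<And>p q. p \<in> K \<Longrightarrow> q \<in> K \<Longrightarrow> dist q p < d \<Longrightarrow> dist (H q) (H p) < e"
    using \<open>e > 0\<close> by (rule uniformly_continuous_onE) blast
  show ?thesis
    unfolding eventually_at_left_field
  proof (intro exI[of _ "max 0 (1 - d)"] conjI allI impI ballI)
    show "max 0 (1 - d) < 1" using d(1) by simp
    fix l :: real and x :: "real ^ 'n"
    assume l: "max 0 (1 - d) < l" "l < 1" and x: "x \<in> unit_cube"
    have "(l, x) \<in> K" "(1, x) \<in> K" "dist (l, x) (1, x) < d"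
      using l x by (auto simp: K_def dist_Pair_Pair dist_real_def)
    from d(2)[OF this(2,1,3)]
    show "\<bar>l ^ k * G (((1 - l) / 2) *\<^sub>R 1 + l *\<^sub>R x) - G x\<bar> < e"
      by (simp add: H_def dist_real_def)
  qed
qed

text \<open>The preimage of the open cube under the dilation is again an open cube. Membership is a
  condition on each coordinate separately, namely to lie in an open interval containing
  \<open>{0..1}\<close>, so replacing a coordinate preserves it.\<close>

lemma coord_stable_dilated_cube:
  fixes l :: real
  assumes l: "0 < l" "l < 1"
  shows "coord_stable {x :: real ^ 'n. ((1 - l) / 2) *\<^sub>R 1 + l *\<^sub>R x \<in> interior unit_cube}"
proof -
  let ?U = "{x :: real ^ 'n. ((1 - l) / 2) *\<^sub>R 1 + l *\<^sub>R x \<in> interior unit_cube}"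
  have mem: "x \<in> ?U \<longleftrightarrow> (\<forall>i. 0 < (1 - l) / 2 + l * x $ i \<and> (1 - l) / 2 + l * x $ i < 1)" for x
    by (simp add: unit_cube_def interior_cbox mem_box_cart)
  have line: "0 < (1 - l) / 2 + l * t \<and> (1 - l) / 2 + l * t < 1" if "0 \<le> t" "t \<le> 1" for t
  proof -
    define p where "p = l * t"
    have "0 \<le> p" "p \<le> l" using that l by (auto simp: p_def mult_left_le)
    then show ?thesis using l unfolding p_def[symmetric] by (simp add: field_simps)
  qed
  show ?thesis
  proof
    have "open ((\<lambda>x :: real ^ 'n. ((1 - l) / 2) *\<^sub>R 1 + l *\<^sub>R x) -` interior unit_cube)"
      by (intro open_vimage continuous_intros) simp
    then show "open ?U" by (simp add: vimage_def)
    show "replace_coord i t x \<in> ?U" if "x \<in> ?U" "0 \<le> t" "t \<le> 1" for x t i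
      using that line[of t] unfolding mem replace_coord_nth by auto
    show "unit_cube \<subseteq> ?U"
      unfolding subset_iff mem using line by (auto simp: unit_cube_def mem_box_cart)
  qed
qed

section \<open>Multi-index derivatives as words, essential suprema, and the conclusion\<close>

lemma multi_deriv_eq_iter_deriv:
  obtains w where "multi_deriv \<alpha> = iter_deriv w" "length w = (\<Sum>i\<in>UNIV. \<alpha> i)"
proof
  let ?w = "concat (map (\<lambda>i. replicate (\<alpha> i) i) (sorted_list_of_set UNIV))"
  have "foldr (\<lambda>i. partial_deriv i ^^ \<alpha> i) xs f = iter_deriv (concat (map (\<lambda>i. replicate (\<alpha> i) i) xs)) f" for xs f
    by (induction xs) (simp_all add: foldr_replicate)
  then show "multi_deriv \<alpha> = iter_deriv ?w"
    unfolding multi_deriv_def by (rule ext)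
  show "length ?w = (\<Sum>i\<in>UNIV. \<alpha> i)"
    by (simp add: length_concat o_def sum_list_distinct_conv_sum_set)
qed

text \<open>The work lies in measurability on the closed cube, which has to come from continuity in
  the interior alone; the bound itself then holds off the null boundary.\<close>

lemma Linfty_norm_unit_cube_le:
  fixes F :: "real ^ 'n \<Rightarrow> real"
  assumes cont: "continuous_on (interior unit_cube) F"
    and bound: "\<And>x. x \<in> interior unit_cube \<Longrightarrow> \<bar>F x\<bar> \<le> C"
  shows "Linfty_norm unit_cube F \<le> ereal C"
proof -
  let ?N = "unit_cube - interior unit_cube :: (real ^ 'n) set"
  have cube: "(unit_cube :: (real ^ 'n) set) \<in> sets lebesgue"
    by (simp add: unit_cube_def)
  have N: "negligible ?N"
    unfolding unit_cube_def interior_cbox by (rule negligible_frontier_interval)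
  have "{x \<in> unit_cube. a < F x} \<in> sets (lebesgue_on unit_cube)" for a
  proof -
    have "open (interior unit_cube \<inter> F -` {a<..})"
      using cont by (intro continuous_open_preimage) auto
    then have "interior unit_cube \<inter> F -` {a<..} \<in> sets lebesgue" by simp
    \<comment> \<open>Values on the boundary are arbitrary, but every subset of a null set is
      Lebesgue measurable.\<close>
    moreover have "{x \<in> ?N. a < F x} \<in> sets lebesgue"
      by (rule negligible_imp_sets[OF negligible_subset[OF N]]) auto
    moreover have "{x \<in> unit_cube. a < F x} = interior unit_cube \<inter> F -` {a<..} \<union> {x \<in> ?N. a < F x}"
      using interior_subset by auto
    ultimately have "{x \<in> unit_cube. a < F x} \<in> sets lebesgue" by simp
    then show ?thesis using cube by (simp add: sets_restrict_space_iff)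
  qed
  then have "F \<in> borel_measurable (lebesgue_on unit_cube)"
    by (intro borel_measurable_iff_greater[THEN iffD2]) simp
  then have "(\<lambda>x. ereal \<bar>F x\<bar>) \<in> borel_measurable (lebesgue_on unit_cube)"
    by measurable
  moreover have "AE x in lebesgue_on unit_cube. ereal \<bar>F x\<bar> \<le> ereal C"
  proof (rule AE_I')
    show "?N \<in> null_sets (lebesgue_on unit_cube)"
      using N cube by (simp add: null_sets_restrict_space negligible_iff_null_sets)
    show "{x \<in> space (lebesgue_on unit_cube). \<not> ereal \<bar>F x\<bar> \<le> ereal C} \<subseteq> ?N"
      using bound by auto
  qed
  ultimately show ?thesis
    unfolding Linfty_norm_def by (rule esssup_I)
qed

theorem mainTheorem1:
  fixes u :: "real ^ 'n::{finite,linorder} \<Rightarrow> real" and m :: nat and \<epsilon> :: real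
  assumes "m > 0"
    and "u \<in> C_closed_cube m"
    and "\<epsilon> > 0"
  shows "\<exists>P. real_polynomial_function P \<and> sobolev_infty_norm m (\<lambda>x. u x - P x) < ereal \<epsilon>"
proof -
  let ?I = "interior unit_cube :: (real ^ 'n::{finite,linorder}) set"
  let ?A = "multi_indices m :: ('n::{finite,linorder} \<Rightarrow> nat) set"
  have u: "times_cont_diff_on m ?I u"
    and "\<forall>\<alpha>\<in>?A. \<exists>g. continuous_on unit_cube g \<and> (\<forall>x\<in>?I. g x = multi_deriv \<alpha> u x)"
    using assms(2) by (auto simp: C_closed_cube_def)
  then obtain G where G: "\<And>\<alpha>. \<alpha> \<in> ?A \<Longrightarrow> continuous_on unit_cube (G \<alpha>)"
    "\<And>\<alpha> x. \<alpha> \<in> ?A \<Longrightarrow> x \<in> ?I \<Longrightarrow> G \<alpha> x = multi_deriv \<alpha> u x"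
    by metis
  \<comment> \<open>Each multi-index will cost at most \<open>2 * \<eta>\<close>, so the sum over
    \<open>?A\<close> stays strictly below \<epsilon>.\<close>
  define \<eta> where "\<eta> = \<epsilon> / (4 * (real (card ?A) + 1))"
  have \<eta>: "\<eta> > 0" using assms(3) by (simp add: \<eta>_def add_nonneg_pos)
  have "\<forall>\<^sub>F l in at_left 1. \<forall>\<alpha>\<in>?A. \<forall>x\<in>unit_cube.
      \<bar>l ^ (\<Sum>i\<in>UNIV. \<alpha> i) * G \<alpha> (((1 - l) / 2) *\<^sub>R 1 + l *\<^sub>R x) - G \<alpha> x\<bar> < \<eta>"
    using dilation_close[OF G(1) \<eta>] by (intro eventually_ball_finite finite_multi_indices) auto
  moreover have "\<forall>\<^sub>F l in at_left (1::real). 0 < l \<and> l < 1"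
    unfolding eventually_at_left_field by (intro exI[of _ 0]) auto
  ultimately have "\<forall>\<^sub>F l in at_left (1::real). (0 < l \<and> l < 1) \<and> (\<forall>\<alpha>\<in>?A. \<forall>x\<in>unit_cube.
      \<bar>l ^ (\<Sum>i\<in>UNIV. \<alpha> i) * G \<alpha> (((1 - l) / 2) *\<^sub>R 1 + l *\<^sub>R x) - G \<alpha> x\<bar> < \<eta>)"
    by eventually_elim blast
  from eventually_happens[OF this] obtain l :: real where l: "0 < l" "l < 1"
    and close: "\<And>\<alpha> x. \<alpha> \<in> ?A \<Longrightarrow> x \<in> unit_cube \<Longrightarrow>
      \<bar>l ^ (\<Sum>i\<in>UNIV. \<alpha> i) * G \<alpha> (((1 - l) / 2) *\<^sub>R 1 + l *\<^sub>R x) - G \<alpha> x\<bar> < \<eta>"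
    by auto
  define b :: "real ^ 'n::{finite,linorder}" where "b = ((1 - l) / 2) *\<^sub>R 1"
  define U where "U = {x. b + l *\<^sub>R x \<in> ?I}"
  interpret coord_stable U
    unfolding U_def b_def by (rule coord_stable_dilated_cube[OF l])
  have U: "b + l *\<^sub>R x \<in> ?I" if "x \<in> U" for x using that by (simp add: U_def)
  define v where "v x = u (b + l *\<^sub>R x)" for x
  have "times_cont_diff_on m U v"
    using times_cont_diff_on_dilate[OF open_U U u, of 1] by (simp add: v_def[abs_def])
  from polynomial_approx[OF this \<eta>] obtain P where P: "real_polynomial_function P"
    "times_cont_diff_on m U P"
    "\<And>w x. length w \<le> m \<Longrightarrow> x \<in> unit_cube \<Longrightarrow> \<bar>iter_deriv w P x - iter_deriv w v x\<bar> < \<eta>"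
    by blast
  have IU: "?I \<subseteq> U" using interior_subset unit_cube_subset by blast
  have P_I: "times_cont_diff_on m ?I P"
    by (rule times_cont_diff_on_subset[OF P(2) IU])
  have "Linfty_norm unit_cube (multi_deriv \<alpha> (\<lambda>x. u x - P x)) \<le> ereal (2 * \<eta>)" if \<alpha>: "\<alpha> \<in> ?A" for \<alpha>
  proof -
    obtain w where w: "multi_deriv \<alpha> = iter_deriv w" "length w = (\<Sum>i\<in>UNIV. \<alpha> i)"
      by (rule multi_deriv_eq_iter_deriv)
    have len: "length w \<le> m" using \<alpha> w(2) by (simp add: multi_indices_def)
    have eq: "iter_deriv w (\<lambda>x. u x - P x) x = iter_deriv w u x - iter_deriv w P x" if "x \<in> ?I" for x
      by (rule iter_deriv_diff[OF open_interior u P_I len that])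
    show ?thesis
      unfolding w(1)
    proof (rule Linfty_norm_unit_cube_le)
      have "continuous_on ?I (\<lambda>x. iter_deriv w u x - iter_deriv w P x)"
        by (intro continuous_intros iter_deriv_continuous[OF u len] iter_deriv_continuous[OF P_I len])
      then show "continuous_on ?I (iter_deriv w (\<lambda>x. u x - P x))"
        by (rule continuous_on_eq) (simp add: eq)
      fix x assume x: "x \<in> ?I"
      then have xc: "x \<in> unit_cube" and xU: "x \<in> U" using interior_subset IU by blast+
      have "iter_deriv w v x = l ^ length w * G \<alpha> (b + l *\<^sub>R x)"
        using iter_deriv_dilate[OF open_U U u len xU] G(2)[OF \<alpha> U[OF xU]] w(1)
        by (simp add: v_def[abs_def])
      moreover have "iter_deriv w u x = G \<alpha> x"
        using G(2)[OF \<alpha> x] w(1) by simp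
      \<comment> \<open>Triangle inequality through \<open>iter_deriv w v x\<close>: one \<eta> for
        the polynomial approximation of \<open>v\<close>, one for the dilation.\<close>
      ultimately show "\<bar>iter_deriv w (\<lambda>x. u x - P x) x\<bar> \<le> 2 * \<eta>"
        using P(3)[OF len xc] close[OF \<alpha> xc, folded b_def w(2)] unfolding eq[OF x] by linarith
    qed
  qed
  then have "sobolev_infty_norm m (\<lambda>x. u x - P x) \<le> (\<Sum>\<alpha>\<in>?A. ereal (2 * \<eta>))"
    unfolding sobolev_infty_norm_def by (rule sum_mono)
  also have "\<dots> = ereal (real (card ?A) * (2 * \<eta>))"
    by simp
  also have "\<dots> < ereal \<epsilon>"
  proof -
    have "real (card ?A) * (2 * \<eta>) < (4 * (real (card ?A) + 1)) * \<eta>"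
      using \<eta> by (simp add: algebra_simps add_pos_nonneg)
    also have "\<dots> = \<epsilon>" by (simp add: \<eta>_def add_nonneg_pos)
    finally show ?thesis by simp
  qed
  finally show ?thesis using P(1) by blast
qed

end
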